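(* Every bijective cellular automaton is reversible.
   Context: An alphabet is a finite set with at least two elements, given the discrete topology. For a finitely generated group $G$, $A^G$ has the product topology; for $c\in A^G$, $g\in G$, $c^g\in A^G$ is given by $c^g(h)=c(gh)$. A subshift of $A^G$ is a closed subset invariant under all the maps $c\mapsto c^g$. For finite $\mathcal{N}\subseteq G$ and $f:A^{\mathcal{N}}\to A$, $(F^{A,G}_f(c))(g)=f(c^g|_{\mathcal{N}})$. A cellular automaton (CA) with alphabet $A$ and tessellation group $G$ (a finitely generated group) is a triple $\mathcal{A}=\langle X,\mathcal{N},f\rangle$ with $X\subseteq A^G$ a subshift (the support), $\mathcal{N}\subseteq G$ finite, $f:A^{\mathcal{N}}\to A$, and $F^{A,G}_f(X)\subseteq X$; its global evolution function $F_{\mathcal{A}}:X\to X$ is the restriction of $F^{A,G}_f$ to $X$. $\mathcal{A}$ is bijective if $F_{\mathcal{A}}:X\to X$ is bijective. $\mathcal{A}$ is reversible if there exists a CA $\mathcal{A}'$ with the same alphabet, tessellation group, and support $X$ as $\mathcal{A}$, such that $F_{\mathcal{A}'}\circ F_{\mathcal{A}}$ and $F_{\mathcal{A}}\circ F_{\mathcal{A}'}$ both coincide with the identity function of $X$. *)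

theory Defs
  imports "HOL-Analysis.Function_Topology" "HOL-Algebra.Generated_Groups"
begin

definition alphabet :: "'a set \<Rightarrow> bool" where
  "alphabet A \<longleftrightarrow> finite A \<and> 2 \<le> card A"

definition finitely_generated_group :: "('g, 'b) monoid_scheme \<Rightarrow> bool" where
  "finitely_generated_group G \<longleftrightarrow>
     group G \<and> (\<exists>S. finite S \<and> S \<subseteq> carrier G \<and> generate G S = carrier G)"

text \<open>
  Configurations are the extensional functions in \<open>carrier G \<rightarrow>\<^sub>E A\<close>, which is the
  underlying set of the following space.
\<close>

definition config_topology :: "'a set \<Rightarrow> ('g, 'b) monoid_scheme \<Rightarrow> ('g \<Rightarrow> 'a) topology" where
  "config_topology A G = product_topology (\<lambda>_. discrete_topology A) (carrier G)"

definition translate :: "('g, 'b) monoid_scheme \<Rightarrow> 'g \<Rightarrow> ('g \<Rightarrow> 'a) \<Rightarrow> ('g \<Rightarrow> 'a)" where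
  "translate G g c = (\<lambda>h\<in>carrier G. c (g \<otimes>\<^bsub>G\<^esub> h))"

definition subshift :: "'a set \<Rightarrow> ('g, 'b) monoid_scheme \<Rightarrow> ('g \<Rightarrow> 'a) set \<Rightarrow> bool" where
  "subshift A G X \<longleftrightarrow>
     closedin (config_topology A G) X \<and> (\<forall>g\<in>carrier G. \<forall>c\<in>X. translate G g c \<in> X)"

definition full_evolution ::
    "('g, 'b) monoid_scheme \<Rightarrow> 'g set \<Rightarrow> (('g \<Rightarrow> 'a) \<Rightarrow> 'a) \<Rightarrow> ('g \<Rightarrow> 'a) \<Rightarrow> ('g \<Rightarrow> 'a)" where
  "full_evolution G N f c = (\<lambda>g\<in>carrier G. f (restrict (translate G g c) N))"

record ('a, 'g) ca_data =
  support :: "('g \<Rightarrow> 'a) set"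
  neighborhood :: "'g set"
  local_rule :: "('g \<Rightarrow> 'a) \<Rightarrow> 'a"

definition cellular_automaton ::
    "'a set \<Rightarrow> ('g, 'b) monoid_scheme \<Rightarrow> ('a, 'g) ca_data \<Rightarrow> bool" where
  "cellular_automaton A G \<A> \<longleftrightarrow>
     alphabet A \<and> finitely_generated_group G \<and>
     subshift A G (support \<A>) \<and>
     finite (neighborhood \<A>) \<and> neighborhood \<A> \<subseteq> carrier G \<and>
     local_rule \<A> \<in> (neighborhood \<A> \<rightarrow>\<^sub>E A) \<rightarrow>\<^sub>E A \<and>
     full_evolution G (neighborhood \<A>) (local_rule \<A>) ` support \<A> \<subseteq> support \<A>"

definition global_evolution ::
    "('g, 'b) monoid_scheme \<Rightarrow> ('a, 'g) ca_data \<Rightarrow> ('g \<Rightarrow> 'a) \<Rightarrow> ('g \<Rightarrow> 'a)" where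
  "global_evolution G \<A> =
     restrict (full_evolution G (neighborhood \<A>) (local_rule \<A>)) (support \<A>)"

definition bijective_ca :: "('g, 'b) monoid_scheme \<Rightarrow> ('a, 'g) ca_data \<Rightarrow> bool" where
  "bijective_ca G \<A> \<longleftrightarrow> bij_betw (global_evolution G \<A>) (support \<A>) (support \<A>)"

definition reversible_ca ::
    "'a set \<Rightarrow> ('g, 'b) monoid_scheme \<Rightarrow> ('a, 'g) ca_data \<Rightarrow> bool" where
  "reversible_ca A G \<A> \<longleftrightarrow>
     (\<exists>\<A>'. cellular_automaton A G \<A>' \<and> support \<A>' = support \<A> \<and>
        (\<forall>c\<in>support \<A>. global_evolution G \<A>' (global_evolution G \<A> c) = c) \<and>
        (\<forall>c\<in>support \<A>. global_evolution G \<A> (global_evolution G \<A>' c) = c))"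

end

theory Submission
  imports Defs "HOL-Analysis.T1_Spaces"
begin

text \<open>
  The configuration space is a product of finite discrete spaces, hence compact and Hausdorff, and
  so is the support. The evolution function is continuous, so if it is bijective, then it is a
  homeomorphism of the support. Its inverse is therefore continuous, and it commutes with
  translations because the evolution function does (lemma \<open>full_evolution_translate\<close>).
  That the inverse is given by a local rule is the argument of Curtis, Hedlund and Lyndon. By
  continuity and compactness the state at \<open>\<one>\<close> of the inverse image of \<open>c\<close> depends on only finitely
  many cells of \<open>c\<close> (lemma \<open>continuous_imp_finitely_determined\<close>), and equivariance transports
  this dependence to every other cell (lemma \<open>equivariant_continuous_imp_local_rule\<close>).
\<close>

section \<open>Continuity in products of discrete spaces\<close>

lemma openin_cylinder:
  assumes "finite N" "N \<subseteq> I"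
  shows "openin (product_topology (\<lambda>_. discrete_topology A) I) {x \<in> I \<rightarrow>\<^sub>E A. \<forall>i\<in>N. x i = c i}"
proof -
  let ?V = "\<lambda>i. if i \<in> N then A \<inter> {c i} else A"
  have "{x \<in> I \<rightarrow>\<^sub>E A. \<forall>i\<in>N. x i = c i} = Pi\<^sub>E I ?V"
  proof (intro equalityI subsetI)
    fix x assume "x \<in> Pi\<^sub>E I ?V"
    then have V: "x i \<in> ?V i" if "i \<in> I" for i
      using that by (rule PiE_mem)
    have "x i \<in> A" if "i \<in> I" for i
      using V[OF that] by (cases "i \<in> N") auto
    moreover have "x i = c i" if "i \<in> N" for i
      using V[of i] that assms(2) by auto
    ultimately show "x \<in> {x \<in> I \<rightarrow>\<^sub>E A. \<forall>i\<in>N. x i = c i}"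
      using \<open>x \<in> Pi\<^sub>E I ?V\<close> by (simp add: PiE_iff)
  qed (auto simp: PiE_iff)
  moreover have "finite {i \<in> I. ?V i \<noteq> topspace (discrete_topology A)}"
    by (rule finite_subset[OF _ assms(1)]) auto
  ultimately show ?thesis
    by (auto simp: openin_PiE_gen)
qed

text \<open>
  Around every point of \<open>X\<close> there is a cylinder on which \<open>h\<close> is constant, namely the one that
  fixes the coordinates in \<open>N\<close>.
\<close>

lemma finitely_determined_imp_continuous:
  assumes "finite N" "N \<subseteq> I" and into: "h \<in> X \<rightarrow> B"
    and det: "\<And>c d. c \<in> X \<Longrightarrow> d \<in> X \<Longrightarrow> (\<And>i. i \<in> N \<Longrightarrow> c i = d i) \<Longrightarrow> h c = h d"
  shows "continuous_map (subtopology (product_topology (\<lambda>_. discrete_topology A) I) X)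
    (discrete_topology B) h"
  unfolding continuous_map_def
proof (intro conjI allI impI)
  let ?T = "product_topology (\<lambda>_. discrete_topology A) I"
  show "h \<in> topspace (subtopology ?T X) \<rightarrow> topspace (discrete_topology B)"
    using into by auto
  fix U
  show "openin (subtopology ?T X) {x \<in> topspace (subtopology ?T X). h x \<in> U}"
  proof (subst openin_subopen, intro ballI)
    fix c assume c: "c \<in> {x \<in> topspace (subtopology ?T X). h x \<in> U}"
    let ?C = "{x \<in> I \<rightarrow>\<^sub>E A. \<forall>i\<in>N. x i = c i} \<inter> X"
    have "openin (subtopology ?T X) ?C"
      using openin_cylinder[OF assms(1,2)] by (auto simp: openin_subtopology)
    moreover have "c \<in> ?C"
      using c by auto
    moreover have "?C \<subseteq> {x \<in> topspace (subtopology ?T X). h x \<in> U}"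
    proof
      fix x assume x: "x \<in> ?C"
      then have "h x = h c"
        using c by (intro det) auto
      then show "x \<in> {x \<in> topspace (subtopology ?T X). h x \<in> U}"
        using x c by simp
    qed
    ultimately show "\<exists>V. openin (subtopology ?T X) V \<and> c \<in> V \<and>
        V \<subseteq> {x \<in> topspace (subtopology ?T X). h x \<in> U}"
      by blast
  qed
qed

text \<open>
  By continuity, around every point \<open>c\<close> of \<open>X\<close> there is a cylinder, fixing the coordinates in a finite
  set \<open>M c\<close>, on which \<open>h\<close> is constant. Finitely many of these cylinders cover the compact set
  \<open>X\<close>; the coordinates in the union of their sets \<open>M c\<close> decide which of them contain a given
  point, and hence the value of \<open>h\<close> there.
\<close>

lemma continuous_imp_finitely_determined:
  assumes cpt: "compactin (product_topology (\<lambda>_. discrete_topology A) I) X"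
    and cont: "continuous_map (subtopology (product_topology (\<lambda>_. discrete_topology A) I) X)
      (discrete_topology B) h"
  obtains N where "finite N" "N \<subseteq> I"
    and "\<And>c d. c \<in> X \<Longrightarrow> d \<in> X \<Longrightarrow> (\<And>i. i \<in> N \<Longrightarrow> c i = d i) \<Longrightarrow> h c = h d"
proof -
  let ?T = "product_topology (\<lambda>_. discrete_topology A) I"
  let ?C = "\<lambda>c N. {x \<in> I \<rightarrow>\<^sub>E A. \<forall>i\<in>N. x i = c i}"
  have X: "X \<subseteq> I \<rightarrow>\<^sub>E A"
    using compactin_subset_topspace[OF cpt] by simp
  have "\<exists>N. finite N \<and> N \<subseteq> I \<and> (\<forall>x\<in>?C c N \<inter> X. h x = h c)" if c: "c \<in> X" for c
  proof -
    have "h c \<in> B"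
      using cont c X by (auto simp: continuous_map_def)
    then have "openin (subtopology ?T X) {x \<in> topspace (subtopology ?T X). h x \<in> {h c}}"
      by (intro openin_continuous_map_preimage[OF cont]) simp
    then obtain U where U: "openin ?T U" "{x \<in> topspace (subtopology ?T X). h x \<in> {h c}} = U \<inter> X"
      by (auto simp: openin_subtopology)
    have "c \<in> U"
      using U(2) c X by auto
    then obtain V where V: "finite {i \<in> I. V i \<noteq> A}" "c \<in> Pi\<^sub>E I V" "Pi\<^sub>E I V \<subseteq> U"
      using U(1) by (auto simp: openin_product_topology_alt)
    have "?C c {i \<in> I. V i \<noteq> A} \<subseteq> Pi\<^sub>E I V"
    proof
      fix x assume x: "x \<in> ?C c {i \<in> I. V i \<noteq> A}"
      have "x i \<in> V i" if "i \<in> I" for i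
        using x V(2) that by (cases "V i = A") (auto simp: PiE_iff)
      then show "x \<in> Pi\<^sub>E I V"
        using x by (auto simp: PiE_iff)
    qed
    then have sub: "?C c {i \<in> I. V i \<noteq> A} \<inter> X \<subseteq> {x \<in> topspace (subtopology ?T X). h x \<in> {h c}}"
      unfolding U(2) using V(3) by (meson Int_mono order_refl order_trans)
    have "h x = h c" if "x \<in> ?C c {i \<in> I. V i \<noteq> A} \<inter> X" for x
      using subsetD[OF sub that] by simp
    then show ?thesis
      using V(1) by (intro exI[of _ "{i \<in> I. V i \<noteq> A}"] conjI ballI) simp_all
  qed
  then have "\<forall>c\<in>X. \<exists>N. finite N \<and> N \<subseteq> I \<and> (\<forall>x\<in>?C c N \<inter> X. h x = h c)"
    by (rule ballI)
  from bchoice[OF this] obtain M where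
    M_spec: "\<forall>c\<in>X. finite (M c) \<and> M c \<subseteq> I \<and> (\<forall>x\<in>?C c (M c) \<inter> X. h x = h c)"
    by (rule exE)
  have M: "finite (M c)" "M c \<subseteq> I" if "c \<in> X" for c
    using M_spec that by auto
  have const: "h x = h c" if "c \<in> X" "x \<in> ?C c (M c)" "x \<in> X" for c x
    using bspec[OF M_spec that(1)] that(2,3) by blast
  have "\<And>U. U \<in> (\<lambda>c. ?C c (M c)) ` X \<Longrightarrow> openin ?T U"
    using openin_cylinder[OF M] by auto
  moreover have "X \<subseteq> \<Union>((\<lambda>c. ?C c (M c)) ` X)"
    using X by blast
  ultimately obtain \<F> where "finite \<F>" "\<F> \<subseteq> (\<lambda>c. ?C c (M c)) ` X" "X \<subseteq> \<Union>\<F>"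
    using cpt unfolding compactin_def by meson
  then obtain K where K: "finite K" "K \<subseteq> X" "X \<subseteq> (\<Union>c\<in>K. ?C c (M c))"
    using finite_subset_image[of \<F> "\<lambda>c. ?C c (M c)" X] by auto
  show thesis
  proof
    show "finite (\<Union>c\<in>K. M c)" "(\<Union>c\<in>K. M c) \<subseteq> I"
      using K(1,2) M by (auto simp: subset_iff)
    fix c d assume cd: "c \<in> X" "d \<in> X" and eq: "\<And>i. i \<in> (\<Union>c\<in>K. M c) \<Longrightarrow> c i = d i"
    obtain k where k: "k \<in> K" "c \<in> ?C k (M k)"
      using K(3) cd(1) by blast
    have "d i = k i" if "i \<in> M k" for i
      using k eq[of i] that by force
    then have "d \<in> ?C k (M k)"
      using cd(2) X by auto
    then show "h c = h d"
      using const[of k c] const[of k d] k K(2) cd by (simp add: subset_iff)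
  qed
qed

section \<open>Translations and local rules\<close>

lemma translate_translate:
  assumes "group G" "g \<in> carrier G" "h \<in> carrier G"
  shows "translate G h (translate G g c) = translate G (g \<otimes>\<^bsub>G\<^esub> h) c"
proof -
  interpret group G by fact
  show ?thesis
    using assms(2,3) by (auto simp: translate_def m_assoc)
qed

lemma full_evolution_translate:
  assumes "group G" "g \<in> carrier G"
  shows "full_evolution G N f (translate G g c) = translate G g (full_evolution G N f c)"
proof -
  interpret group G by fact
  show ?thesis
    unfolding full_evolution_def translate_def[of G g "restrict _ _"]
    by (rule restrict_ext) (simp add: assms(2) translate_translate[OF assms])
qed

lemma subshift_configurations:
  assumes "subshift A G X"
  shows "X \<subseteq> carrier G \<rightarrow>\<^sub>E A"
  using assms closedin_subset by (fastforce simp: subshift_def config_topology_def)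

lemma compactin_subshift:
  assumes "finite A" "subshift A G X"
  shows "compactin (config_topology A G) X"
proof (rule closedin_compact_space)
  show "compact_space (config_topology A G)"
    using assms(1) by (simp add: config_topology_def compact_space_product_topology
        compact_space_discrete_topology)
  show "closedin (config_topology A G) X"
    using assms(2) by (simp add: subshift_def)
qed

lemma continuous_map_full_evolution:
  assumes "group G" "finite N" "N \<subseteq> carrier G" "f \<in> (N \<rightarrow>\<^sub>E A) \<rightarrow> A" "X \<subseteq> carrier G \<rightarrow>\<^sub>E A"
  shows "continuous_map (subtopology (config_topology A G) X) (config_topology A G)
    (full_evolution G N f)"
  unfolding config_topology_def continuous_map_componentwise
proof (intro conjI ballI)
  interpret group G by fact
  show "full_evolution G N f ` topspace (subtopology
      (product_topology (\<lambda>_. discrete_topology A) (carrier G)) X) \<subseteq> extensional (carrier G)"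
    by (auto simp: full_evolution_def)
  fix g assume g: "g \<in> carrier G"
  show "continuous_map (subtopology (product_topology (\<lambda>_. discrete_topology A) (carrier G)) X)
      (discrete_topology A) (\<lambda>c. full_evolution G N f c g)"
  proof (rule finitely_determined_imp_continuous[of "(\<lambda>n. g \<otimes>\<^bsub>G\<^esub> n) ` N"])
    show "finite ((\<lambda>n. g \<otimes>\<^bsub>G\<^esub> n) ` N)" "(\<lambda>n. g \<otimes>\<^bsub>G\<^esub> n) ` N \<subseteq> carrier G"
      using assms(2,3) g by auto
    show "(\<lambda>c. full_evolution G N f c g) \<in> X \<rightarrow> A"
    proof
      fix c assume "c \<in> X"
      then have "restrict (translate G g c) N \<in> N \<rightarrow>\<^sub>E A"
        using assms(3,5) g by (force simp: translate_def PiE_iff)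
      then show "full_evolution G N f c g \<in> A"
        using funcset_mem[OF assms(4)] g by (simp add: full_evolution_def)
    qed
    fix c d assume "c \<in> X" "d \<in> X" and "\<And>i. i \<in> (\<lambda>n. g \<otimes>\<^bsub>G\<^esub> n) ` N \<Longrightarrow> c i = d i"
    then have "restrict (translate G g c) N = restrict (translate G g d) N"
      using assms(3) by (auto simp: translate_def)
    then show "full_evolution G N f c g = full_evolution G N f d g"
      by (simp add: full_evolution_def)
  qed
qed

text \<open>
  This is the Curtis--Hedlund--Lyndon theorem, in the direction from topology to local rules.
  The value of \<open>H c\<close> at \<open>\<one>\<close> is a function of the pattern of \<open>c\<close> on some finite \<open>N\<close>; this function
  is the local rule. It suffices, because the value of \<open>H c\<close> at \<open>g\<close> is by equivariance the value of \<open>H (translate G g c)\<close> at \<open>\<one>\<close>.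
\<close>

lemma equivariant_continuous_imp_local_rule:
  assumes "group G" "finite A" "A \<noteq> {}" "subshift A G X" and into: "H \<in> X \<rightarrow> X"
    and cont: "continuous_map (subtopology (config_topology A G) X) (config_topology A G) H"
    and equiv: "\<And>c g. c \<in> X \<Longrightarrow> g \<in> carrier G \<Longrightarrow> H (translate G g c) = translate G g (H c)"
  obtains N f where "finite N" "N \<subseteq> carrier G" "f \<in> (N \<rightarrow>\<^sub>E A) \<rightarrow>\<^sub>E A"
    and "\<And>c. c \<in> X \<Longrightarrow> full_evolution G N f c = H c"
proof -
  interpret group G by fact
  have X: "X \<subseteq> carrier G \<rightarrow>\<^sub>E A"
    using assms(4) by (rule subshift_configurations)
  have "continuous_map (subtopology (config_topology A G) X) (discrete_topology A) (\<lambda>c. H c \<one>\<^bsub>G\<^esub>)"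
    using cont by (simp add: config_topology_def continuous_map_componentwise)
  then obtain N where N: "finite N" "N \<subseteq> carrier G"
    and det: "\<And>c d. c \<in> X \<Longrightarrow> d \<in> X \<Longrightarrow> (\<And>i. i \<in> N \<Longrightarrow> c i = d i) \<Longrightarrow> H c \<one>\<^bsub>G\<^esub> = H d \<one>\<^bsub>G\<^esub>"
    using compactin_subshift[OF assms(2,4)] continuous_imp_finitely_determined
    unfolding config_topology_def by metis
  obtain a where a: "a \<in> A"
    using assms(3) by blast
  \<comment> \<open>The chosen \<open>c\<close> is immaterial, by \<open>det\<close>. A pattern that no configuration in \<open>X\<close> shows gets
    the arbitrary state \<open>a\<close>: a local rule must be defined on all patterns.\<close>
  define f where "f = (\<lambda>p\<in>N \<rightarrow>\<^sub>E A. if \<exists>c\<in>X. restrict c N = p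
    then H (SOME c. c \<in> X \<and> restrict c N = p) \<one>\<^bsub>G\<^esub> else a)"
  have f_pattern: "f (restrict c N) = H c \<one>\<^bsub>G\<^esub>" if c: "c \<in> X" for c
  proof -
    let ?d = "SOME d. d \<in> X \<and> restrict d N = restrict c N"
    have d: "?d \<in> X \<and> restrict ?d N = restrict c N"
      by (rule someI[of _ c]) (use c in simp)
    have "restrict c N \<in> N \<rightarrow>\<^sub>E A"
      using c X N(2) by auto
    then have "f (restrict c N) = H ?d \<one>\<^bsub>G\<^esub>"
      using c by (auto simp: f_def)
    also have "\<dots> = H c \<one>\<^bsub>G\<^esub>"
    proof (rule det)
      show "?d \<in> X" "c \<in> X"
        using d c by auto
      show "?d i = c i" if "i \<in> N" for i
        using fun_cong[OF conjunct2[OF d], of i] that by (simp only: restrict_apply if_True)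
    qed
    finally show ?thesis .
  qed
  have "f \<in> (N \<rightarrow>\<^sub>E A) \<rightarrow>\<^sub>E A"
  proof
    fix p assume p: "p \<in> N \<rightarrow>\<^sub>E A"
    show "f p \<in> A"
    proof (cases "\<exists>c\<in>X. restrict c N = p")
      case True
      then obtain c where "c \<in> X" "restrict c N = p" by blast
      then show ?thesis
        using f_pattern[of c] funcset_mem[OF into, of c] X by auto
    next
      case False
      then show ?thesis
        using p a by (simp add: f_def)
    qed
  qed (simp add: f_def)
  moreover have "full_evolution G N f c = H c" if c: "c \<in> X" for c
  proof (rule extensionalityI[where A = "carrier G"])
    show "full_evolution G N f c \<in> extensional (carrier G)"
      by (simp add: full_evolution_def)
    show "H c \<in> extensional (carrier G)"
      using funcset_mem[OF into c] X by (auto simp: PiE_def)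
    fix g assume g: "g \<in> carrier G"
    have "translate G g c \<in> X"
      using assms(4) c g by (simp add: subshift_def)
    then have "full_evolution G N f c g = H (translate G g c) \<one>\<^bsub>G\<^esub>"
      using g f_pattern by (simp add: full_evolution_def)
    also have "\<dots> = H c g"
      using equiv[OF c g] g by (simp add: translate_def)
    finally show "full_evolution G N f c g = H c g" .
  qed
  ultimately show thesis
    using N that by blast
qed

section \<open>Bijective cellular automata\<close>

theorem corollary3:
  fixes A :: "'a set" and G :: "('g, 'b) monoid_scheme" and \<A> :: "('a, 'g) ca_data"
  assumes "cellular_automaton A G \<A>"
    and "bijective_ca G \<A>"
  shows "reversible_ca A G \<A>"
proof -
  define X where "X = support \<A>"
  define F where "F = full_evolution G (neighborhood \<A>) (local_rule \<A>)"
  let ?T = "config_topology A G"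
  have A: "finite A" "A \<noteq> {}" and fg: "finitely_generated_group G" and sub: "subshift A G X"
    and N: "finite (neighborhood \<A>)" "neighborhood \<A> \<subseteq> carrier G"
    and rule: "local_rule \<A> \<in> (neighborhood \<A> \<rightarrow>\<^sub>E A) \<rightarrow> A"
    using assms(1) unfolding cellular_automaton_def alphabet_def X_def by auto
  have G: "group G"
    using fg by (simp add: finitely_generated_group_def)
  have X: "X \<subseteq> topspace ?T"
    using sub closedin_subset by (auto simp: subshift_def)
  have glob: "global_evolution G \<A> c = F c" if "c \<in> X" for c
    using that by (simp add: global_evolution_def F_def X_def)
  have bij: "bij_betw F X X"
    using assms(2) glob unfolding bijective_ca_def X_def[symmetric] by (metis bij_betw_cong)
  have trans: "translate G g c \<in> X" if "c \<in> X" "g \<in> carrier G" for c g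
    using sub that by (simp add: subshift_def)
  have top: "topspace (subtopology ?T X) = X"
    using X by auto

  have "homeomorphic_map (subtopology ?T X) (subtopology ?T X) F"
  proof (rule continuous_imp_homeomorphic_map)
    show "compact_space (subtopology ?T X)"
      using compactin_subshift[OF A(1) sub] by (rule compact_space_subtopology)
    show "Hausdorff_space (subtopology ?T X)"
      by (simp add: config_topology_def Hausdorff_space_product_topology
          Hausdorff_space_subtopology)
    show "continuous_map (subtopology ?T X) (subtopology ?T X) F"
      using continuous_map_full_evolution[OF G N rule subshift_configurations[OF sub]] bij
      by (auto simp: continuous_map_in_subtopology F_def bij_betw_def)
    show "F ` topspace (subtopology ?T X) = topspace (subtopology ?T X)"
      "inj_on F (topspace (subtopology ?T X))"
      using bij unfolding top by (auto simp: bij_betw_def)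
  qed
  then obtain H where "homeomorphic_maps (subtopology ?T X) (subtopology ?T X) F H"
    by (auto simp: homeomorphic_map_maps)
  then have contH: "continuous_map (subtopology ?T X) (subtopology ?T X) H"
    and HF: "\<And>c. c \<in> X \<Longrightarrow> H (F c) = c" and FH: "\<And>c. c \<in> X \<Longrightarrow> F (H c) = c"
    unfolding homeomorphic_maps_def top by auto
  have H: "H \<in> X \<rightarrow> X"
    using contH unfolding continuous_map_def top by blast
  have "H (translate G g c) = translate G g (H c)" if "c \<in> X" "g \<in> carrier G" for c g
  proof -
    have "translate G g c = F (translate G g (H c))"
      using FH[OF that(1)] by (simp add: F_def full_evolution_translate[OF G that(2)])
    then show ?thesis
      using HF trans H that by (metis funcset_mem)
  qed
  then obtain N' f' where N': "finite N'" "N' \<subseteq> carrier G" "f' \<in> (N' \<rightarrow>\<^sub>E A) \<rightarrow>\<^sub>E A"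
    and F': "\<And>c. c \<in> X \<Longrightarrow> full_evolution G N' f' c = H c"
    using equivariant_continuous_imp_local_rule[OF G A sub H]
      continuous_map_into_fulltopology[OF contH] by metis

  define \<A>' where "\<A>' = \<lparr>support = X, neighborhood = N', local_rule = f'\<rparr>"
  have glob': "global_evolution G \<A>' c = H c" if "c \<in> X" for c
    using that F' by (simp add: global_evolution_def \<A>'_def)
  have "cellular_automaton A G \<A>'"
    using assms(1) N' F' H sub by (auto simp: cellular_automaton_def \<A>'_def)
  moreover have "F c \<in> X" if "c \<in> X" for c
    using bij that by (auto simp: bij_betw_def)
  moreover have "H c \<in> X" if "c \<in> X" for c
    using H that by (rule funcset_mem)
  ultimately show ?thesis
    unfolding reversible_ca_def X_def[symmetric]
    by (intro exI[of _ \<A>'] conjI ballI) (simp_all add: glob glob' HF FH, simp add: \<A>'_def)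
qed

end
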